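(* Let $n\geq 2$, let $\{\lambda_{n;m}\}_{m=1}^{n}$ and $\{\mu_m\}_{m=1}^{n}$ be nonincreasing sequences of real numbers, and suppose $\{\lambda_{n;m}\}_{m=1}^{n}\succeq\{\mu_{m}\}_{m=1}^{n}$. Define $\{\lambda_{n-1;m}\}_{m=1}^{n-1}$ according to Top Kill, that is, pick any $k\in\{1,\dots,n-1\}$ such that $\lambda_{n;k+1}\leq\mu_{n}\leq\lambda_{n;k}$, and for each $m=1,\ldots,n-1$, define $$\lambda_{n-1;m}:=\left\{\begin{array}{ll}\lambda_{n;m},&1\leq m\leq k-1,\\ \lambda_{n;k}+\lambda_{n;k+1}-\mu_{n},&m=k,\\ \lambda_{n;m+1},&k+1\leq m\leq n-1.\end{array}\right.$$ Then $\{\lambda_{n-1;m}\}_{m=1}^{n-1}\sqsubseteq\{\lambda_{n;m}\}_{m=1}^{n}$ and $\{\lambda_{n-1;m}\}_{m=1}^{n-1}\succeq\{\mu_m\}_{m=1}^{n-1}$. Furthermore, given any nonnegative nonincreasing sequences $\{\lambda_{n}\}_{n=1}^N$ and $\{\mu_{n}\}_{n=1}^N$ such that $\{\lambda_{n}\}_{n=1}^N\succeq\{\mu_{n}\}_{n=1}^N$, define $\lambda_{N;m}:=\lambda_m$ for every $m=1,\ldots,N$, and for each $n=N,N-1,\ldots,2$, consecutively define $\{\lambda_{n-1;m}\}_{m=1}^{n-1}$ from $\{\lambda_{n;m}\}_{m=1}^{n}$ according to Top Kill (the rule above). Then $\{\{\lambda_{n;m}\}_{m=1}^n\}_{n=1}^N$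 is a sequence of inner eigensteps corresponding to $\{\lambda_n\}_{n=1}^N$ and $\{\mu_n\}_{n=1}^N$.
   Context: Majorization: for nonincreasing real sequences $\{\lambda_m\}_{m=1}^n$ and $\{\mu_m\}_{m=1}^n$, one writes $\{\lambda_m\}_{m=1}^n\succeq\{\mu_m\}_{m=1}^n$ if $\sum_{m=1}^j\lambda_m\geq\sum_{m=1}^j\mu_m$ for all $j=1,\dots,n-1$ and $\sum_{m=1}^n\lambda_m=\sum_{m=1}^n\mu_m$. Interlacing: one writes $\{\alpha_m\}_{m=1}^{n-1}\sqsubseteq\{\beta_m\}_{m=1}^{n}$ if $\beta_{m+1}\leq\alpha_m\leq\beta_m$ for all $m=1,\ldots,n-1$. Inner eigensteps: let $\{\lambda_n\}_{n=1}^{N}$ and $\{\mu_n\}_{n=1}^{N}$ be nonnegative nonincreasing sequences. A corresponding sequence of inner eigensteps is a sequence of sequences $\{\{\lambda_{n;m}\}_{m=1}^{n}\}_{n=1}^{N}$ satisfying: (i) $\lambda_{N;m}=\lambda_m$ for every $m=1,\ldots,N$; (ii) $\{\lambda_{n-1;m}\}_{m=1}^{n-1}\sqsubseteq\{\lambda_{n;m}\}_{m=1}^{n}$ for every $n=2,\dots,N$; (iii) $\sum_{m=1}^{n}\lambda_{n;m}=\sum_{m=1}^{n}\mu_{m}$ for every $n=1,\dots,N$. *)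

theory Defs
  imports Complex_Main
begin

text \<open>
  A finite sequence \<open>x\<^sub>1, \<dots>, x\<^sub>n\<close> of reals is a function \<open>nat \<Rightarrow> real\<close> of which only the values
  on \<open>{1..n}\<close> matter; the length \<open>n\<close> is passed explicitly. A triangular array \<open>\<lambda>\<^sub>n\<^sub>;\<^sub>m\<close> is
  \<open>L n m\<close>.
\<close>

text \<open>
  Majorization is only defined between nonincreasing sequences, so monotonicity of both
  sequences is part of the predicate.
\<close>
definition majorizes :: "nat \<Rightarrow> (nat \<Rightarrow> real) \<Rightarrow> (nat \<Rightarrow> real) \<Rightarrow> bool" where
  "majorizes n lam mu \<longleftrightarrow>
     antimono_on {1..n} lam \<and> antimono_on {1..n} mu \<and>
     (\<forall>j\<in>{1..n - 1}. (\<Sum>m=1..j. lam m) \<ge> (\<Sum>m=1..j. mu m)) \<and>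
     (\<Sum>m=1..n. lam m) = (\<Sum>m=1..n. mu m)"

text \<open>The parameter \<open>n\<close> is the length of the longer sequence \<open>b\<close>; \<open>a\<close> has length \<open>n - 1\<close>.\<close>
definition interlaces :: "nat \<Rightarrow> (nat \<Rightarrow> real) \<Rightarrow> (nat \<Rightarrow> real) \<Rightarrow> bool" where
  "interlaces n a b \<longleftrightarrow> (\<forall>m\<in>{1..n - 1}. b (m + 1) \<le> a m \<and> a m \<le> b m)"

definition inner_eigensteps ::
    "nat \<Rightarrow> (nat \<Rightarrow> real) \<Rightarrow> (nat \<Rightarrow> real) \<Rightarrow> (nat \<Rightarrow> nat \<Rightarrow> real) \<Rightarrow> bool" where
  "inner_eigensteps N lam mu L \<longleftrightarrow>
     (\<forall>n\<in>{1..N}. lam n \<ge> 0) \<and> antimono_on {1..N} lam \<and>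
     (\<forall>n\<in>{1..N}. mu n \<ge> 0) \<and> antimono_on {1..N} mu \<and>
     (\<forall>m\<in>{1..N}. L N m = lam m) \<and>
     (\<forall>n\<in>{2..N}. interlaces n (L (n - 1)) (L n)) \<and>
     (\<forall>n\<in>{1..N}. (\<Sum>m=1..n. L n m) = (\<Sum>m=1..n. mu m))"

definition top_kill_index :: "nat \<Rightarrow> (nat \<Rightarrow> real) \<Rightarrow> (nat \<Rightarrow> real) \<Rightarrow> nat \<Rightarrow> bool" where
  "top_kill_index n lam mu k \<longleftrightarrow> k \<in> {1..n - 1} \<and> lam (k + 1) \<le> mu n \<and> mu n \<le> lam k"

text \<open>
  A relation rather than a function, since the index \<open>k\<close> need not be unique: \<open>lam'\<close>, of length
  \<open>n - 1\<close>, arises from \<open>lam\<close>, of length \<open>n\<close>, by some admissible choice of \<open>k\<close>.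
\<close>
definition top_kill ::
    "nat \<Rightarrow> (nat \<Rightarrow> real) \<Rightarrow> (nat \<Rightarrow> real) \<Rightarrow> (nat \<Rightarrow> real) \<Rightarrow> bool" where
  "top_kill n mu lam lam' \<longleftrightarrow>
     (\<exists>k. top_kill_index n lam mu k \<and>
       (\<forall>m\<in>{1..n - 1}. lam' m =
          (if m \<le> k - 1 then lam m
           else if m = k then lam k + lam (k + 1) - mu n
           else lam (m + 1))))"

definition top_kill_array ::
    "nat \<Rightarrow> (nat \<Rightarrow> real) \<Rightarrow> (nat \<Rightarrow> real) \<Rightarrow> (nat \<Rightarrow> nat \<Rightarrow> real) \<Rightarrow> bool" where
  "top_kill_array N lam mu L \<longleftrightarrow>
     (\<forall>m\<in>{1..N}. L N m = lam m) \<and>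
     (\<forall>n\<in>{2..N}. top_kill n mu (L n) (L (n - 1)))"

end

theory Submission
  imports Defs
begin

text \<open>
  Write \<open>k\<close> for the index chosen by Top Kill. Everything follows from the shape of the partial sums
  of the new sequence \<open>lam'\<close>: up to \<open>j < k\<close> they are those of \<open>lam\<close>, and from \<open>j = k\<close> on they are
  those of \<open>lam\<close> over one more term, minus \<open>mu n\<close> (\<open>sum_top_kill\<close>). Dominating the partial sums of
  \<open>mu\<close> is therefore inherited: below \<open>k\<close> directly, and from \<open>k\<close> on because
  \<open>mu (j + 1) - mu n \<ge> 0\<close>. At \<open>j = n - 1\<close> that difference vanishes, so the equality of the total
  sums is inherited as well. Interlacing is immediate except at position \<open>k\<close>, where it says exactly
  \<open>lam (k + 1) \<le> mu n \<le> lam k\<close>. It also makes the new sequence nonincreasing, because the new terms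
  are separated by the terms of \<open>lam\<close>.

  An admissible \<open>k\<close> exists because majorization, at its first and at its last partial sum, gives
  \<open>lam n \<le> mu n \<le> lam 1\<close>, so that \<open>lam\<close> must cross the level \<open>mu n\<close> somewhere.

  Since Top Kill preserves majorization, it can be repeated down to length 1, every row majorizes
  the corresponding initial segment of \<open>mu\<close>, and the defining conditions of inner eigensteps are
  read off from the rows.
\<close>

section \<open>Existence of an admissible index\<close>

lemma majorizes_sum_le:
  assumes "majorizes n lam mu" and "1 \<le> j" and "j \<le> n"
  shows "(\<Sum>m=1..j. mu m) \<le> (\<Sum>m=1..j. lam m)"
  using assms by (cases "j = n") (auto simp: majorizes_def)

lemma majorizes_last_le:
  assumes "majorizes n lam mu" and "n \<ge> 2"
  shows "lam n \<le> mu n"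
proof -
  obtain p where p: "n = Suc p" "p \<ge> 1"
    using assms(2) by (cases n) auto
  have "(\<Sum>m=1..p. lam m) \<ge> (\<Sum>m=1..p. mu m)"
    and "(\<Sum>m=1..Suc p. lam m) = (\<Sum>m=1..Suc p. mu m)"
    using assms(1) p by (auto simp: majorizes_def)
  then show ?thesis
    using p by simp
qed

lemma majorizes_last_le_first:
  assumes "majorizes n lam mu" and "n \<ge> 2"
  shows "mu n \<le> lam 1"
proof -
  have "mu n \<le> mu 1"
    using assms by (auto simp: majorizes_def intro: monotone_onD)
  also have "\<dots> \<le> lam 1"
    using majorizes_sum_le[OF assms(1), of 1] assms(2) by simp
  finally show ?thesis .
qed

lemma top_kill_index_exists:
  assumes "majorizes n lam mu" and "n \<ge> 2"
  shows "\<exists>k. top_kill_index n lam mu k"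
proof -
  \<comment> \<open>The last index below \<open>n\<close> at which \<open>lam\<close> is still above the level \<open>mu n\<close>.\<close>
  define K where "K = {k \<in> {1..n - 1}. mu n \<le> lam k}"
  define k where "k = Max K"
  have "finite K" and "1 \<in> K"
    using majorizes_last_le_first[OF assms] assms(2) by (auto simp: K_def)
  then have k: "k \<in> K" and max: "\<And>i. i \<in> K \<Longrightarrow> i \<le> k"
    unfolding k_def by (auto intro: Max_in)
  have "lam (k + 1) \<le> mu n"
  proof (cases "k + 1 = n")
    case True
    then show ?thesis
      using majorizes_last_le[OF assms] by simp
  next
    case False
    then have "k + 1 \<in> {1..n - 1}"
      using k by (auto simp: K_def)
    moreover have "k + 1 \<notin> K"
      using max[of "k + 1"] by auto
    ultimately show ?thesis
      by (simp add: K_def)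
  qed
  then show ?thesis
    using k by (auto simp: top_kill_index_def K_def)
qed

lemma top_kill_exists:
  assumes "majorizes n lam mu" and "n \<ge> 2"
  shows "\<exists>lam'. top_kill n mu lam lam'"
proof -
  obtain k where "top_kill_index n lam mu k"
    using top_kill_index_exists[OF assms] by blast
  then show ?thesis
    unfolding top_kill_def
    by (intro exI[of _ "\<lambda>m. if m \<le> k - 1 then lam m
          else if m = k then lam k + lam (k + 1) - mu n else lam (m + 1)"] exI[of _ k]) simp
qed

lemma top_kill_cong:
  assumes "\<And>m. m \<in> {1..n - 1} \<Longrightarrow> lam' m = lam'' m"
  shows "top_kill n mu lam lam' \<longleftrightarrow> top_kill n mu lam lam''"
  using assms by (simp add: top_kill_def)

section \<open>Interlacing and preservation of majorization\<close>

lemma top_killE: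
  assumes "top_kill n mu lam lam'"
  obtains k where "1 \<le> k" "k \<le> n - 1" "lam (k + 1) \<le> mu n" "mu n \<le> lam k"
    and "\<And>m. 1 \<le> m \<Longrightarrow> m < k \<Longrightarrow> lam' m = lam m"
    and "lam' k = lam k + lam (k + 1) - mu n"
    and "\<And>m. k < m \<Longrightarrow> m \<le> n - 1 \<Longrightarrow> lam' m = lam (m + 1)"
proof -
  obtain k where k: "k \<in> {1..n - 1}" "lam (k + 1) \<le> mu n" "mu n \<le> lam k"
    and lam': "\<And>m. m \<in> {1..n - 1} \<Longrightarrow> lam' m =
      (if m \<le> k - 1 then lam m else if m = k then lam k + lam (k + 1) - mu n else lam (m + 1))"
    using assms unfolding top_kill_def top_kill_index_def by blast
  show thesis
    by (rule that[of k]) (use k in \<open>auto simp: lam'\<close>)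
qed

text \<open>
  Position \<open>k\<close> is where the two terms \<open>lam k\<close> and \<open>lam (k + 1)\<close> are merged and \<open>mu n\<close> is taken away;
  all later terms are merely shifted by one.
\<close>
lemma sum_top_kill:
  fixes lam lam' :: "nat \<Rightarrow> real"
  assumes "1 \<le> k"
    and before: "\<And>m. 1 \<le> m \<Longrightarrow> m < k \<Longrightarrow> lam' m = lam m"
    and at: "lam' k = lam k + lam (k + 1) - c"
    and after: "\<And>m. k < m \<Longrightarrow> m \<le> N \<Longrightarrow> lam' m = lam (m + 1)"
    and "j \<le> N"
  shows "(\<Sum>m=1..j. lam' m) =
    (if j < k then (\<Sum>m=1..j. lam m) else (\<Sum>m=1..j + 1. lam m) - c)"
  using \<open>j \<le> N\<close>
proof (induction j)
  case 0
  then show ?case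
    using \<open>1 \<le> k\<close> by simp
next
  case (Suc j)
  consider "Suc j < k" | "Suc j = k" | "k < Suc j"
    by linarith
  then show ?case
  proof cases
    case 1
    then show ?thesis
      using Suc before[of "Suc j"] by simp
  next
    case 2
    then show ?thesis
      using Suc at by auto
  next
    case 3
    then show ?thesis
      using Suc after[of "Suc j"] by simp
  qed
qed

lemma interlaces_antimono:
  assumes "interlaces n a b" and b: "antimono_on {1..n} b"
  shows "antimono_on {1..n - 1} a"
proof (rule monotone_onI)
  fix r s
  assume rs: "r \<in> {1..n - 1}" "s \<in> {1..n - 1}" "r \<le> s"
  show "a s \<le> a r"
  proof (cases "r = s")
    case False
    have "a s \<le> b s"
      using assms(1) rs by (simp add: interlaces_def)
    also have "b s \<le> b (r + 1)"
      by (rule monotone_onD[OF b]) (use rs False in auto)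
    also have "b (r + 1) \<le> a r"
      using assms(1) rs by (simp add: interlaces_def)
    finally show ?thesis .
  qed simp
qed

lemma top_kill_interlaces:
  assumes "top_kill n mu lam lam'" and lam: "antimono_on {1..n} lam"
  shows "interlaces n lam' lam"
  using assms(1)
proof (rule top_killE)
  fix k
  assume k: "1 \<le> k" "k \<le> n - 1" "lam (k + 1) \<le> mu n" "mu n \<le> lam k"
    and before: "\<And>m. 1 \<le> m \<Longrightarrow> m < k \<Longrightarrow> lam' m = lam m"
    and at: "lam' k = lam k + lam (k + 1) - mu n"
    and after: "\<And>m. k < m \<Longrightarrow> m \<le> n - 1 \<Longrightarrow> lam' m = lam (m + 1)"
  show ?thesis
    unfolding interlaces_def
  proof
    fix m
    assume m: "m \<in> {1..n - 1}"
    then have step: "lam (m + 1) \<le> lam m"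
      by (intro monotone_onD[OF lam]) auto
    consider "m < k" | "m = k" | "k < m"
      by linarith
    then show "lam (m + 1) \<le> lam' m \<and> lam' m \<le> lam m"
      by cases (use m k at before[of m] after[of m] step in auto)
  qed
qed

lemma top_kill_majorizes:
  assumes kill: "top_kill n mu lam lam'" and maj: "majorizes n lam mu"
  shows "majorizes (n - 1) lam' mu"
  using kill
proof (rule top_killE)
  fix k
  assume k: "1 \<le> k" "k \<le> n - 1"
    and before: "\<And>m. 1 \<le> m \<Longrightarrow> m < k \<Longrightarrow> lam' m = lam m"
    and at: "lam' k = lam k + lam (k + 1) - mu n"
    and after: "\<And>m. k < m \<Longrightarrow> m \<le> n - 1 \<Longrightarrow> lam' m = lam (m + 1)"
  note sums = sum_top_kill[of k lam' lam "mu n" "n - 1", OF k(1) before at after]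
  have lam: "antimono_on {1..n} lam" and mu: "antimono_on {1..n} mu"
    and total: "(\<Sum>m=1..n. lam m) = (\<Sum>m=1..n. mu m)"
    using maj by (auto simp: majorizes_def)
  note dom = majorizes_sum_le[OF maj]
  have "n = Suc (n - 1)"
    using k by simp
  have "antimono_on {1..n - 1} lam'"
    using interlaces_antimono[OF top_kill_interlaces[OF kill lam] lam] .
  moreover have "antimono_on {1..n - 1} mu"
    using mu by (rule monotone_on_subset) auto
  moreover have "(\<Sum>m=1..j. mu m) \<le> (\<Sum>m=1..j. lam' m)" if j: "j \<in> {1..n - 1}" for j
  proof (cases "j < k")
    case True
    then show ?thesis
      using sums[of j] dom[of j] j by auto
  next
    case False
    have "mu n \<le> mu (j + 1)"
      by (rule monotone_onD[OF mu]) (use j in auto)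
    then have "(\<Sum>m=1..j. mu m) \<le> (\<Sum>m=1..j + 1. mu m) - mu n"
      by simp
    also have "\<dots> \<le> (\<Sum>m=1..j + 1. lam m) - mu n"
      using dom[of "j + 1"] j by auto
    also have "\<dots> = (\<Sum>m=1..j. lam' m)"
      using sums[of j] False j by simp
    finally show ?thesis .
  qed
  moreover have "(\<Sum>m=1..n - 1. lam' m) = (\<Sum>m=1..n - 1. mu m)"
  proof -
    have "(\<Sum>m=1..n - 1. lam' m) = (\<Sum>m=1..n. lam m) - mu n"
      using sums[of "n - 1"] k \<open>n = Suc (n - 1)\<close> by simp
    also have "\<dots> = (\<Sum>m=1..Suc (n - 1). mu m) - mu n"
      using total \<open>n = Suc (n - 1)\<close> by simp
    also have "\<dots> = (\<Sum>m=1..n - 1. mu m)"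
      using \<open>n = Suc (n - 1)\<close> by (subst sum.cl_ivl_Suc) simp
    finally show ?thesis .
  qed
  ultimately show ?thesis
    by (auto simp: majorizes_def)
qed

section \<open>Iterating Top Kill\<close>

text \<open>
  The induction puts a new top row above an array for the shorter sequence obtained by one Top Kill
  step.
\<close>
lemma top_kill_array_exists:
  assumes "N \<ge> 1" and "majorizes N lam mu"
  shows "\<exists>L. top_kill_array N lam mu L"
  using assms
proof (induction N arbitrary: lam rule: nat_induct_at_least)
  case base
  show ?case
    by (rule exI[of _ "\<lambda>_. lam"]) (simp add: top_kill_array_def)
next
  case (Suc N)
  have "Suc N \<ge> 2"
    using Suc.hyps by simp
  then obtain lam' where kill: "top_kill (Suc N) mu lam lam'"
    using top_kill_exists[OF Suc.prems] by blast
  have "majorizes N lam' mu"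
    using top_kill_majorizes[OF kill Suc.prems] by simp
  then obtain L where L: "top_kill_array N lam' mu L"
    using Suc.IH by blast
  \<comment> \<open>Row \<open>N\<close> of \<open>L\<close> is known to agree with \<open>lam'\<close> on \<open>{1..N}\<close> only.\<close>
  have "top_kill (Suc N) mu lam (L N)"
    using kill L by (subst top_kill_cong[where lam'' = lam']) (auto simp: top_kill_array_def)
  then have "top_kill_array (Suc N) lam mu (L(Suc N := lam))"
    using L Suc.hyps by (auto simp: top_kill_array_def le_Suc_eq)
  then show ?case
    by blast
qed

lemma majorizes_cong:
  assumes "\<And>m. m \<in> {1..n} \<Longrightarrow> lam m = lam' m"
  shows "majorizes n lam mu \<longleftrightarrow> majorizes n lam' mu"
proof -
  have sums: "(\<Sum>m=1..j. lam m) = (\<Sum>m=1..j. lam' m)" if "j \<le> n" for j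
    using assms that by (intro sum.cong) auto
  have "(\<forall>j\<in>{1..n - 1}. (\<Sum>m=1..j. lam m) \<ge> (\<Sum>m=1..j. mu m)) \<longleftrightarrow>
      (\<forall>j\<in>{1..n - 1}. (\<Sum>m=1..j. lam' m) \<ge> (\<Sum>m=1..j. mu m))"
    by (rule ball_cong[OF refl], subst sums) auto
  moreover have "antimono_on {1..n} lam \<longleftrightarrow> antimono_on {1..n} lam'"
    using assms by (simp add: monotone_on_def)
  ultimately show ?thesis
    using sums[of n] by (simp add: majorizes_def)
qed

lemma top_kill_array_majorizes:
  assumes L: "top_kill_array N lam mu L" and maj: "majorizes N lam mu"
    and n: "1 \<le> n" "n \<le> N"
  shows "majorizes n (L n) mu"
  using n(2,1)
proof (induction n rule: inc_induct)
  case base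
  then show ?case
    using L maj by (subst majorizes_cong[where lam' = lam]) (auto simp: top_kill_array_def)
next
  case (step n)
  have "top_kill (Suc n) mu (L (Suc n)) (L n)"
    using L step unfolding top_kill_array_def by (auto dest!: bspec[where x = "Suc n"])
  then show ?case
    using top_kill_majorizes[of "Suc n"] step by simp
qed

lemma top_kill_array_inner_eigensteps:
  assumes "\<forall>n\<in>{1..N}. lam n \<ge> 0" and "\<forall>n\<in>{1..N}. mu n \<ge> 0"
    and L: "top_kill_array N lam mu L" and maj: "majorizes N lam mu"
  shows "inner_eigensteps N lam mu L"
proof -
  note rows = top_kill_array_majorizes[OF L maj]
  have "interlaces n (L (n - 1)) (L n)" if "n \<in> {2..N}" for n
    using L rows[of n] that
    by (intro top_kill_interlaces[where mu = mu]) (auto simp: top_kill_array_def majorizes_def)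
  moreover have "(\<Sum>m=1..n. L n m) = (\<Sum>m=1..n. mu m)" if "n \<in> {1..N}" for n
    using rows[of n] that by (simp add: majorizes_def)
  ultimately show ?thesis
    using assms by (simp add: inner_eigensteps_def top_kill_array_def majorizes_def)
qed

theorem theorem3p2:
  "(\<forall>(n::nat) (lam::nat \<Rightarrow> real) (mu::nat \<Rightarrow> real).
      n \<ge> 2 \<longrightarrow> antimono_on {1..n} lam \<longrightarrow> antimono_on {1..n} mu \<longrightarrow> majorizes n lam mu \<longrightarrow>
        (\<exists>k. top_kill_index n lam mu k) \<and>
        (\<forall>lam'. top_kill n mu lam lam' \<longrightarrow>
           interlaces n lam' lam \<and> majorizes (n - 1) lam' mu)) \<and>
   (\<forall>(N::nat) (lam::nat \<Rightarrow> real) (mu::nat \<Rightarrow> real).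
      N \<ge> 1 \<longrightarrow>
      (\<forall>n\<in>{1..N}. lam n \<ge> 0) \<longrightarrow> antimono_on {1..N} lam \<longrightarrow>
      (\<forall>n\<in>{1..N}. mu n \<ge> 0) \<longrightarrow> antimono_on {1..N} mu \<longrightarrow>
      majorizes N lam mu \<longrightarrow>
        (\<exists>L. top_kill_array N lam mu L) \<and>
        (\<forall>L. top_kill_array N lam mu L \<longrightarrow> inner_eigensteps N lam mu L))"
proof (intro conjI allI impI)
  fix n :: nat and lam mu lam' :: "nat \<Rightarrow> real"
  assume n: "n \<ge> 2" and lam: "antimono_on {1..n} lam" and maj: "majorizes n lam mu"
  show "\<exists>k. top_kill_index n lam mu k"
    using top_kill_index_exists[OF maj n] .
  assume kill: "top_kill n mu lam lam'"
  show "interlaces n lam' lam"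
    using top_kill_interlaces[OF kill lam] .
  show "majorizes (n - 1) lam' mu"
    using top_kill_majorizes[OF kill maj] .
next
  fix N :: nat and lam mu :: "nat \<Rightarrow> real" and L
  assume N: "N \<ge> 1" and nonneg: "\<forall>n\<in>{1..N}. lam n \<ge> 0" "\<forall>n\<in>{1..N}. mu n \<ge> 0"
    and maj: "majorizes N lam mu"
  show "\<exists>L. top_kill_array N lam mu L"
    using top_kill_array_exists[OF N maj] .
  assume "top_kill_array N lam mu L"
  then show "inner_eigensteps N lam mu L"
    using top_kill_array_inner_eigensteps nonneg maj by blast
qed

end
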